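(* Let $m\geq 3$ and let $G=S(2,1^{m-1})$ be the starlike tree of order $m+2$ (the tree on vertices $o,x_1,\dots,x_m,y$ with edges $ox_1,\dots,ox_m,x_1y$). Then $$b(G)=\begin{cases}\frac{m^2}{2}-1 & \text{if } m \text{ is even},\\ \binom{m+1}{2} & \text{if } m \text{ is odd}.\end{cases}$$
   Context: All graphs are finite and simple. For vertices $u,v$ of a graph $G$, $d_G(u,v)$ is the length of a shortest $u$–$v$ path. For an edge $xy$ of $G$, $W^G_{xy}=\{u\in V(G): d_G(u,x)<d_G(u,y)\}$. A graph is distance-balanced if $|W^G_{xy}|=|W^G_{yx}|$ for every edge $xy$. For a graph $H$, $b(H)$ is the smallest number of edges which can be added to $H$ (keeping the vertex set) so that the resulting graph is distance-balanced. A starlike tree is a tree with exactly one vertex of degree greater than two; $S(n_1^{\alpha_1},\dots,n_k^{\alpha_k})$ denotes the starlike tree in which deleting the central vertex leaves $\alpha_i$ paths with $n_i$ vertices for each $i$. *)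

theory Defs
  imports Complex_Main "HOL-Library.Multiset" "HOL-Library.Extended_Nat"
begin

text \<open>A graph is given by its vertex set \<open>V\<close> and its set \<open>E\<close> of edges, each edge being a
  two-element subset of \<open>V\<close>.\<close>

definition simple_graph :: "'a set \<Rightarrow> 'a set set \<Rightarrow> bool" where
  "simple_graph V E \<longleftrightarrow> finite V \<and> (\<forall>e\<in>E. e \<subseteq> V \<and> card e = 2)"

definition degree :: "'a set set \<Rightarrow> 'a \<Rightarrow> nat" where
  "degree E v = card {e \<in> E. v \<in> e}"

text \<open>Paths are represented by the lists of their vertices, so that the path \<open>p\<close> has
  \<open>length p - 1\<close> edges.\<close>

definition is_path :: "'a set \<Rightarrow> 'a set set \<Rightarrow> 'a \<Rightarrow> 'a list \<Rightarrow> 'a \<Rightarrow> bool" where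
  "is_path V E u p v \<longleftrightarrow> p \<noteq> [] \<and> hd p = u \<and> last p = v \<and> distinct p \<and> set p \<subseteq> V \<and>
     (\<forall>i. Suc i < length p \<longrightarrow> {p ! i, p ! Suc i} \<in> E)"

text \<open>The distance is \<open>\<infinity>\<close> if there is no path.\<close>

definition gdist :: "'a set \<Rightarrow> 'a set set \<Rightarrow> 'a \<Rightarrow> 'a \<Rightarrow> enat" where
  "gdist V E u v = (INF p \<in> {p. is_path V E u p v}. enat (length p - 1))"

definition W :: "'a set \<Rightarrow> 'a set set \<Rightarrow> 'a \<Rightarrow> 'a \<Rightarrow> 'a set" where
  "W V E x y = {u \<in> V. gdist V E u x < gdist V E u y}"

definition distance_balanced :: "'a set \<Rightarrow> 'a set set \<Rightarrow> bool" where
  "distance_balanced V E \<longleftrightarrow> (\<forall>x y. {x, y} \<in> E \<longrightarrow> card (W V E x y) = card (W V E y x))"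

text \<open>The set of admissible numbers of added edges is nonempty (lemma \<open>b_attained\<close> below), so
  the \<open>LEAST\<close> is a genuine minimum.\<close>

definition b :: "'a set \<Rightarrow> 'a set set \<Rightarrow> nat" where
  "b V E = (LEAST k. \<exists>F. F \<inter> E = {} \<and> card F = k \<and>
     simple_graph V (E \<union> F) \<and> distance_balanced V (E \<union> F))"

definition connected_graph :: "'a set \<Rightarrow> 'a set set \<Rightarrow> bool" where
  "connected_graph V E \<longleftrightarrow> V \<noteq> {} \<and> (\<forall>u\<in>V. \<forall>v\<in>V. \<exists>p. is_path V E u p v)"

definition is_cycle :: "'a set \<Rightarrow> 'a set set \<Rightarrow> 'a list \<Rightarrow> bool" where
  "is_cycle V E q \<longleftrightarrow> length q \<ge> 3 \<and> distinct q \<and> set q \<subseteq> V \<and>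
     (\<forall>i < length q. {q ! i, q ! (Suc i mod length q)} \<in> E)"

definition is_tree :: "'a set \<Rightarrow> 'a set set \<Rightarrow> bool" where
  "is_tree V E \<longleftrightarrow> simple_graph V E \<and> connected_graph V E \<and> \<not> (\<exists>q. is_cycle V E q)"

definition components :: "'a set \<Rightarrow> 'a set set \<Rightarrow> 'a set set" where
  "components V E = (\<lambda>u. {v \<in> V. \<exists>p. is_path V E u p v}) ` V"

definition path_graph :: "'a set \<Rightarrow> 'a set set \<Rightarrow> bool" where
  "path_graph V E \<longleftrightarrow> (\<exists>p. p \<noteq> [] \<and> distinct p \<and> set p = V \<and>
     E = {{p ! i, p ! Suc i} | i. Suc i < length p})"

text \<open>\<open>starlike_tree V E N\<close>: the graph is the starlike tree \<open>S(N)\<close>, where the multiset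
  \<open>N\<close> contains the number of vertices \<open>n\<^sub>i\<close> of a branch with its multiplicity \<open>\<alpha>\<^sub>i\<close>.  Deleting the centre \<open>c\<close>
  leaves the graph with vertex set \<open>V - {c}\<close> and edge set \<open>{e \<in> E. c \<notin> e}\<close>.\<close>

definition starlike_tree :: "'a set \<Rightarrow> 'a set set \<Rightarrow> nat multiset \<Rightarrow> bool" where
  "starlike_tree V E N \<longleftrightarrow> is_tree V E \<and>
     (\<exists>c\<in>V. degree E c > 2 \<and> (\<forall>v\<in>V. degree E v > 2 \<longrightarrow> v = c) \<and>
        (let K = components (V - {c}) {e \<in> E. c \<notin> e} in
           (\<forall>C\<in>K. path_graph C {e \<in> E. e \<subseteq> C}) \<and> image_mset card (mset_set K) = N))"

lemma is_path_Nil: "u \<in> V \<Longrightarrow> is_path V E u [u] u"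
  by (simp add: is_path_def)

lemma is_path_edge: "\<lbrakk>{u, v} \<in> E; u \<noteq> v; u \<in> V; v \<in> V\<rbrakk> \<Longrightarrow> is_path V E u [u, v] v"
  by (simp add: is_path_def)

lemma is_path_two:
  "\<lbrakk>{u, w} \<in> E; {w, v} \<in> E; distinct [u, w, v]; {u, w, v} \<subseteq> V\<rbrakk> \<Longrightarrow> is_path V E u [u, w, v] v"
  by (auto simp: is_path_def less_Suc_eq)

lemma is_path_three:
  "\<lbrakk>{u, w} \<in> E; {w, z} \<in> E; {z, v} \<in> E; distinct [u, w, z, v]; {u, w, z, v} \<subseteq> V\<rbrakk>
     \<Longrightarrow> is_path V E u [u, w, z, v] v"
  by (auto simp: is_path_def less_Suc_eq)

lemma gdist_self: "u \<in> V \<Longrightarrow> gdist V E u u = 0"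
proof -
  assume "u \<in> V"
  then have "gdist V E u u \<le> enat (length [u] - 1)"
    unfolding gdist_def by (intro INF_lower) (simp add: is_path_Nil)
  then show ?thesis by (simp add: zero_enat_def[symmetric])
qed

lemma gdist_pos: "u \<noteq> v \<Longrightarrow> gdist V E u v \<ge> 1"
  unfolding gdist_def
proof (rule INF_greatest)
  fix p assume "u \<noteq> v" "p \<in> {p. is_path V E u p v}"
  then have "length p \<noteq> 0" "length p \<noteq> Suc 0"
    by (auto simp: is_path_def length_Suc_conv)
  then have "1 \<le> length p - 1" by linarith
  then show "1 \<le> enat (length p - 1)" by (simp add: one_enat_def)
qed

lemma gdist_edge: "\<lbrakk>{u, v} \<in> E; u \<noteq> v; u \<in> V; v \<in> V\<rbrakk> \<Longrightarrow> gdist V E u v = 1"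
proof -
  assume a: "{u, v} \<in> E" "u \<noteq> v" "u \<in> V" "v \<in> V"
  then have "gdist V E u v \<le> enat (length [u, v] - 1)"
    unfolding gdist_def by (intro INF_lower) (simp add: is_path_edge)
  with gdist_pos[OF a(2), of V E] show ?thesis by (simp add: one_enat_def)
qed

lemma complete_distance_balanced: "distance_balanced V {e. e \<subseteq> V \<and> card e = 2}"
proof -
  let ?K = "{e. e \<subseteq> V \<and> card e = 2}"
  have "W V ?K x y = {x}" if e: "{x, y} \<in> ?K" for x y
  proof -
    have xy: "x \<noteq> y" "x \<in> V" "y \<in> V" using e by auto
    have d: "gdist V ?K u v = (if u = v then 0 else 1)" if "u \<in> V" "v \<in> V" for u v
      using that by (auto simp: gdist_self intro!: gdist_edge)
    show ?thesis unfolding W_def using xy by (auto simp: d split: if_splits)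
  qed
  then show ?thesis
    unfolding distance_balanced_def
  proof (intro allI impI)
    fix x y assume eq: "\<And>x y. {x, y} \<in> ?K \<Longrightarrow> W V ?K x y = {x}" and e: "{x, y} \<in> ?K"
    have "{y, x} \<in> ?K" using e by (simp only: insert_commute)
    then show "card (W V ?K x y) = card (W V ?K y x)" by (simp only: eq[OF e] eq) simp
  qed
qed

lemma b_attained:
  assumes "simple_graph V E"
  shows "\<exists>F. F \<inter> E = {} \<and> card F = b V E \<and>
     simple_graph V (E \<union> F) \<and> distance_balanced V (E \<union> F)"
proof -
  let ?K = "{e. e \<subseteq> V \<and> card e = 2}"
  have "E \<union> (?K - E) = ?K" using assms by (auto simp: simple_graph_def)
  moreover have "simple_graph V ?K" using assms by (auto simp: simple_graph_def)
  ultimately have "\<exists>k F. F \<inter> E = {} \<and> card F = k \<and>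
     simple_graph V (E \<union> F) \<and> distance_balanced V (E \<union> F)"
    using complete_distance_balanced[of V] by (metis Diff_disjoint Int_commute)
  then show ?thesis unfolding b_def by (rule LeastI_ex)
qed

lemma cycle_two_neighbours:
  assumes "is_cycle V E q" "v \<in> set q"
  obtains s t where "s \<in> set q" "t \<in> set q" "s \<noteq> t" "{v, s} \<in> E" "{v, t} \<in> E"
proof -
  let ?n = "length q"
  have n: "?n \<ge> 3" and d: "distinct q" and e: "\<And>i. i < ?n \<Longrightarrow> {q ! i, q ! (Suc i mod ?n)} \<in> E"
    using assms by (auto simp: is_cycle_def)
  obtain i where i: "i < ?n" "q ! i = v" using assms(2) by (meson in_set_conv_nth)
  define j where "j = (if i = 0 then ?n - 1 else i - 1)"
  define k where "k = Suc i mod ?n"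
  have j: "j < ?n" "Suc j mod ?n = i" using i n by (auto simp: j_def)
  have k: "k < ?n" "k \<noteq> j" using i n
    by (auto simp: k_def j_def mod_Suc split: if_splits)
  have "q ! j \<noteq> q ! k" using d j k by (metis nth_eq_iff_index_eq)
  moreover have "{v, q ! j} \<in> E" using e[OF j(1)] j i by (simp add: insert_commute)
  moreover have "{v, q ! k} \<in> E" using e[OF i(1)] i k_def by simp
  ultimately show ?thesis using that j(1) k(1) by (metis nth_mem)
qed

text \<open>The tree with vertices \<open>c, x 1, \<dots>, x m, y\<close> and edges \<open>{c, x i}\<close> and \<open>{x 1, y}\<close> is
  an \<open>S(2, 1\<^bsup>m-1\<^esup>)\<close>.\<close>

lemma starlike_tree_2_1:
  fixes c y :: 'a and x :: "nat \<Rightarrow> 'a"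
  assumes m: "m \<ge> 3" and inj: "inj_on x {1..m}"
    and c: "c \<notin> x ` {1..m}" and y: "y \<notin> x ` {1..m}" and cy: "c \<noteq> y"
  defines "V \<equiv> {c, y} \<union> x ` {1..m}"
  defines "E \<equiv> (\<lambda>i. {c, x i}) ` {1..m} \<union> {{x 1, y}}"
  shows "starlike_tree V E (add_mset 2 (replicate_mset (m - 1) 1))"
proof -
  have x: "x i \<noteq> c" "x i \<noteq> y" "x i \<in> V" "{c, x i} \<in> E" "{x i, c} \<in> E"
    if "1 \<le> i" "i \<le> m" for i
    using that c y by (auto simp: V_def E_def insert_commute)
  have xx: "x i = x j \<longleftrightarrow> i = j" if "1 \<le> i" "i \<le> m" "1 \<le> j" "j \<le> m" for i j
    using that by (intro inj_on_eq_iff[OF inj]) auto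
  have V: "c \<in> V" "y \<in> V" by (auto simp: V_def)
  have x1: "x 1 \<in> V" "x 1 \<noteq> c" "x 1 \<noteq> y" using x[of 1] m by auto
  have ey: "{x 1, y} \<in> E" "{y, x 1} \<in> E" by (auto simp: E_def insert_commute)
  have adj: "{u, v} \<in> E \<longleftrightarrow> (u = c \<and> v \<in> x ` {1..m}) \<or> (v = c \<and> u \<in> x ` {1..m}) \<or>
     (u = x 1 \<and> v = y) \<or> (u = y \<and> v = x 1)" for u v
  proof -
    have "{u, v} \<in> E \<longleftrightarrow> (\<exists>i\<in>{1..m}. {u, v} = {c, x i}) \<or> {u, v} = {x 1, y}"
      unfolding E_def by blast
    then show ?thesis unfolding doubleton_eq_iff by blast
  qed
  have sg: "simple_graph V E"
  proof -
    have "e \<subseteq> V \<and> card e = 2" if e: "e \<in> E" for e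
    proof -
      consider i where "1 \<le> i" "i \<le> m" "e = {c, x i}" | "e = {x 1, y}"
        using e unfolding E_def by auto
      then show ?thesis
      proof cases
        case 1
        with x(1,3)[OF 1(1,2)] V show ?thesis by (simp add: card_insert_if)
      next
        case 2
        with x1 V show ?thesis by (simp add: card_insert_if)
      qed
    qed
    then show ?thesis by (simp add: simple_graph_def V_def)
  qed
  have rev: "\<exists>p. is_path V E v p u" if ex: "\<exists>p. is_path V E u p v" for u v
  proof -
    obtain p where p: "is_path V E u p v" using ex by blast
    have "{rev p ! i, rev p ! Suc i} \<in> E" if i: "Suc i < length p" for i
    proof -
      have "Suc (length p - Suc (Suc i)) = length p - Suc i" using i by simp
      moreover have "{p ! (length p - Suc (Suc i)), p ! Suc (length p - Suc (Suc i))} \<in> E"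
        using p i by (simp add: is_path_def)
      ultimately show ?thesis using i by (simp add: rev_nth insert_commute)
    qed
    then have "is_path V E v (rev p) u" using p by (simp add: is_path_def hd_rev last_rev)
    then show ?thesis by blast
  qed
  have pcx: "\<exists>p. is_path V E c p (x i)" if "1 \<le> i" "i \<le> m" for i
    using is_path_edge[of c "x i" E V] x[OF that] V by metis
  have pcy: "\<exists>p. is_path V E c p y"
    using is_path_two[of c "x 1" E y V] x[of 1] V ey m cy by auto
  have pxx: "\<exists>p. is_path V E (x i) p (x j)" if "1 \<le> i" "i \<le> m" "1 \<le> j" "j \<le> m" for i j
  proof (cases "i = j")
    case True then show ?thesis using is_path_Nil[of "x i" V E] x that by metis
  next
    case False then show ?thesis
      using is_path_two[of "x i" c E "x j" V] x[of i] x[of j] V that xx[of i j] by auto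
  qed
  have pyx: "\<exists>p. is_path V E y p (x i)" if "1 \<le> i" "i \<le> m" for i
  proof (cases "i = 1")
    case True then show ?thesis using is_path_edge[of y "x 1" E V] x1 V ey by metis
  next
    case False then show ?thesis
      using is_path_three[of y "x 1" E c "x i" V] x[of i] x[of 1] V that xx[of i 1] m ey cy
      by auto
  qed
  have VE: "w = c \<or> w = y \<or> (\<exists>i. 1 \<le> i \<and> i \<le> m \<and> w = x i)" if "w \<in> V" for w
    using that unfolding V_def by auto
  have conn: "connected_graph V E"
    unfolding connected_graph_def
  proof (intro conjI ballI)
    fix u v assume "u \<in> V" "v \<in> V"
    then show "\<exists>p. is_path V E u p v"
      using pcx pcy pxx pyx rev is_path_Nil[of c V E] is_path_Nil[of y V E] V VE[of u] VE[of v]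
      by metis
  qed (use V in auto)
  have acyc: "\<not> is_cycle V E q" for q
  proof
    assume q: "is_cycle V E q"
    have ny: "y \<notin> set q"
    proof
      assume "y \<in> set q"
      from cycle_two_neighbours[OF q this] obtain s t
        where "s \<noteq> t" "{y, s} \<in> E" "{y, t} \<in> E" by blast
      then show False using adj y cy x1 by auto
    qed
    have nx: "x i \<notin> set q" if i: "1 \<le> i" "i \<le> m" for i
    proof
      assume "x i \<in> set q"
      from cycle_two_neighbours[OF q this] obtain s t
        where st: "s \<in> set q" "t \<in> set q" "s \<noteq> t" "{x i, s} \<in> E" "{x i, t} \<in> E" by blast
      then have "s \<noteq> y" "t \<noteq> y" using ny by auto
      then have "s = c" "t = c" using st(4,5) adj x[OF i] by auto
      with st(3) show False by simp
    qed
    have "set q \<subseteq> {c}" using q ny nx by (auto simp: is_cycle_def V_def)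
    then have "card (set q) \<le> 1" by (metis card.empty card_mono finite.emptyI finite_insert
      card_insert_disjoint empty_iff One_nat_def)
    moreover have "card (set q) = length q" using q by (simp add: is_cycle_def distinct_card)
    ultimately show False using q by (simp add: is_cycle_def)
  qed
  have tree: "is_tree V E" using sg conn acyc by (auto simp: is_tree_def)
  have "{e \<in> E. c \<in> e} = (\<lambda>i. {c, x i}) ` {1..m}"
    using cy x1 by (auto simp: E_def)
  moreover have "inj_on (\<lambda>i. {c, x i}) {1..m}"
    by (rule inj_onI) (use inj in \<open>auto simp: doubleton_eq_iff dest: inj_onD\<close>)
  ultimately have degc: "degree E c = m" by (simp add: degree_def card_image)
  have "degree E y = card {{x 1, y}}"
  proof -
    have "{e \<in> E. y \<in> e} = {{x 1, y}}" using cy y by (auto simp: E_def)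
    then show ?thesis by (simp add: degree_def)
  qed
  then have degy: "degree E y \<le> 2" by simp
  have degx: "degree E (x i) \<le> 2" if i: "1 \<le> i" "i \<le> m" for i
  proof -
    have "{e \<in> E. x i \<in> e} \<subseteq> {{c, x i}, {x 1, y}}"
    proof
      fix e assume "e \<in> {e \<in> E. x i \<in> e}"
      then have e: "e \<in> E" "x i \<in> e" by auto
      from e(1) consider j where "1 \<le> j" "j \<le> m" "e = {c, x j}" | "e = {x 1, y}"
        unfolding E_def by auto
      then show "e \<in> {{c, x i}, {x 1, y}}"
      proof cases
        case 1
        then have "x i = x j" using e(2) x[OF i] by auto
        then show ?thesis using 1 by simp
      qed simp
    qed
    then have "degree E (x i) \<le> card {{c, x i}, {x 1, y}}"
      unfolding degree_def by (intro card_mono) auto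
    also have "\<dots> \<le> 2" by (simp add: card_insert_if)
    finally show ?thesis .
  qed
  let ?V = "V - {c}" and ?E = "{e \<in> E. c \<notin> e}"
  have Ec: "?E = {{x 1, y}}" using cy x1 by (auto simp: E_def)
  have VV: "?V = insert y (insert (x 1) (x ` {2..m}))"
  proof -
    have "{1..m} = insert 1 {2..m}" using m by auto
    then show ?thesis using c cy unfolding V_def by auto
  qed
  have no: "v = u" if "is_path ?V ?E u p v" "u \<in> x ` {2..m}" for u v p
  proof (rule ccontr)
    assume "v \<noteq> u"
    then have "Suc 0 < length p" using that(1)
      by (cases p rule: list.exhaust; cases "tl p") (auto simp: is_path_def)
    then have "{p ! 0, p ! Suc 0} = {x 1, y}" using that(1) by (simp add: is_path_def Ec)
    moreover have "p ! 0 = u" using that(1) by (auto simp: is_path_def hd_conv_nth)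
    ultimately have "u = x 1 \<or> u = y" by (auto simp: doubleton_eq_iff)
    then show False using that(2) xx y m by fastforce
  qed
  have no': "v \<in> {x 1, y}" if "is_path ?V ?E u p v" "u \<in> {x 1, y}" for u v p
  proof (rule ccontr)
    assume v: "v \<notin> {x 1, y}"
    then have "v \<noteq> u" using that by auto
    then have l: "Suc 0 < length p" using that(1)
      by (cases p rule: list.exhaust; cases "tl p") (auto simp: is_path_def)
    then have "{p ! (length p - 2), p ! Suc (length p - 2)} = {x 1, y}"
      using that(1) unfolding is_path_def Ec by simp
    moreover have "Suc (length p - 2) = length p - 1" using l by simp
    moreover have "p ! (length p - 1) = v" using that(1) by (auto simp: is_path_def last_conv_nth)
    ultimately show False using v by auto
  qed
  define comp where "comp u = {v \<in> ?V. \<exists>p. is_path ?V ?E u p v}" for u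
  have inV: "y \<in> ?V" "x 1 \<in> ?V" "x ` {2..m} \<subseteq> ?V" using VV by auto
  have c1: "comp u = {x 1, y}" if u: "u \<in> {x 1, y}" for u
  proof
    show "comp u \<subseteq> {x 1, y}" using no' u by (auto simp: comp_def)
    have "is_path ?V ?E y [y] y" "is_path ?V ?E (x 1) [x 1] (x 1)"
      using inV by (auto intro: is_path_Nil)
    moreover have "is_path ?V ?E y [y, x 1] (x 1)" "is_path ?V ?E (x 1) [x 1, y] y"
      using inV x1 unfolding Ec by (auto intro!: is_path_edge)
    ultimately show "{x 1, y} \<subseteq> comp u" using u inV unfolding comp_def by blast
  qed
  have c2: "comp u = {u}" if u: "u \<in> x ` {2..m}" for u
  proof
    show "comp u \<subseteq> {u}" using no u by (auto simp: comp_def)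
    show "{u} \<subseteq> comp u" using u inV is_path_Nil[of u ?V ?E] by (auto simp: comp_def)
  qed
  have K: "components ?V ?E = insert {x 1, y} ((\<lambda>u. {u}) ` (x ` {2..m}))"
  proof -
    have "components ?V ?E = comp ` ?V" by (simp add: components_def comp_def[abs_def])
    also have "\<dots> = insert {x 1, y} (comp ` (x ` {2..m}))" unfolding VV using c1 by auto
    also have "comp ` (x ` {2..m}) = (\<lambda>u. {u}) ` (x ` {2..m})" using c2 by (intro image_cong) auto
    finally show ?thesis .
  qed
  have pg1: "path_graph {x 1, y} {e \<in> E. e \<subseteq> {x 1, y}}"
  proof -
    have "{e \<in> E. e \<subseteq> {x 1, y}} = {{x 1, y}}" using cy x1 by (auto simp: E_def)
    moreover have "{{[x 1, y] ! i, [x 1, y] ! Suc i} | i. Suc i < length [x 1, y]} = {{x 1, y}}"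
      by auto
    ultimately show ?thesis unfolding path_graph_def using x1(3)
      by (intro exI[of _ "[x 1, y]"]) simp
  qed
  have pg2: "path_graph {u} {e \<in> E. e \<subseteq> {u}}" for u
  proof -
    have "{e \<in> E. e \<subseteq> {u}} = {}" using cy x1 x by (auto simp: E_def subset_singleton_iff)
    then show ?thesis unfolding path_graph_def by (intro exI[of _ "[u]"]) simp
  qed
  have "{x 1, y} \<notin> (\<lambda>u. {u}) ` (x ` {2..m})" using x1 by auto
  then have "mset_set (components ?V ?E)
      = add_mset {x 1, y} (mset_set ((\<lambda>u. {u}) ` (x ` {2..m})))"
    unfolding K by simp
  moreover have "mset_set ((\<lambda>u. {u}) ` (x ` {2..m})) = image_mset (\<lambda>u. {u}) (mset_set (x ` {2..m}))"
    by (simp add: image_mset_mset_set)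
  moreover have "image_mset card (image_mset (\<lambda>u. {u}) M) = replicate_mset (size M) 1"
    for M :: "'a multiset" by (induction M) auto
  moreover have "card (x ` {2..m}) = m - 1"
    using inj_on_subset[OF inj, of "{2..m}"] by (simp add: card_image)
  ultimately have msz: "image_mset card (mset_set (components ?V ?E))
      = add_mset 2 (replicate_mset (m - 1) 1)"
    using x1 by simp
  have "\<forall>v\<in>V. degree E v > 2 \<longrightarrow> v = c"
    using degy degx unfolding V_def by (auto simp: not_less[symmetric])
  moreover have "\<forall>C\<in>components ?V ?E. path_graph C {e \<in> E. e \<subseteq> C}"
    unfolding K using pg1 pg2 by auto
  moreover have "degree E c > 2" using degc m by simp
  ultimately show ?thesis
    unfolding starlike_tree_def Let_def using tree V(1) msz
    by (intro conjI bexI[of _ c]) assumption+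
qed

end

theory Submission
  imports Defs
begin

text \<open>Let \<open>c\<close> be the centre and \<open>y\<close> the leaf at distance two from it.  A distance-balanced supergraph
  has diameter at most two: if \<open>x\<close> is adjacent to \<open>c\<close> but not to \<open>y\<close>, then
  only \<open>x\<close> is closer to \<open>x\<close> than to \<open>c\<close>, so by balance only \<open>c\<close> is closer to \<open>c\<close>, and hence
  \<open>x\<close> is adjacent to the neighbour \<open>x\<^sub>1\<close> of \<open>y\<close>.  In diameter at most two, being distance-balanced means that
  adjacent vertices have equal degrees, so the supergraph is regular of degree \<open>m\<close> or \<open>m + 1\<close>, and
  counting edges leaves two possible sizes.  Degree \<open>m\<close> on \<open>m + 2\<close> vertices means the
  complement of a perfect matching, which exists precisely for even \<open>m\<close>.\<close>

section \<open>Neighbourhoods, degrees and edge counts\<close>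

definition nbrs :: "'a set set \<Rightarrow> 'a \<Rightarrow> 'a set" where
  "nbrs E v = {w. {v, w} \<in> E}"

lemma mem_nbrs: "w \<in> nbrs E v \<longleftrightarrow> {v, w} \<in> E"
  by (simp add: nbrs_def)

lemma simple_graph_edgeD:
  assumes "simple_graph V E" "{u, v} \<in> E"
  shows "u \<in> V" "v \<in> V" "u \<noteq> v"
  using assms by (auto simp: simple_graph_def)

lemma simple_graph_edgeE:
  assumes "simple_graph V E" "e \<in> E"
  obtains u v where "e = {u, v}" "u \<noteq> v" "u \<in> V" "v \<in> V"
  using assms by (fastforce simp: simple_graph_def card_2_iff)

lemma simple_graph_finite: "simple_graph V E \<Longrightarrow> finite E"
  unfolding simple_graph_def by (rule finite_subset[of _ "Pow V"]) auto

lemma nbrs_subset: "simple_graph V E \<Longrightarrow> nbrs E v \<subseteq> V - {v}"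
  by (auto simp: nbrs_def dest: simple_graph_edgeD)

lemma finite_nbrs: "simple_graph V E \<Longrightarrow> finite (nbrs E v)"
  using nbrs_subset[of V E v] by (auto simp: simple_graph_def intro: finite_subset)

lemma degree_eq_card_nbrs:
  assumes "simple_graph V E"
  shows "degree E v = card (nbrs E v)"
proof -
  have "{e \<in> E. v \<in> e} = (\<lambda>w. {v, w}) ` nbrs E v"
  proof
    show "{e \<in> E. v \<in> e} \<subseteq> (\<lambda>w. {v, w}) ` nbrs E v"
    proof
      fix e assume e: "e \<in> {e \<in> E. v \<in> e}"
      then obtain s t where st: "e = {s, t}" using simple_graph_edgeE[OF assms] by blast
      with e have "e = {v, s} \<or> e = {v, t}" by auto
      with e show "e \<in> (\<lambda>w. {v, w}) ` nbrs E v" by (auto simp: nbrs_def)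
    qed
  qed (auto simp: nbrs_def)
  moreover have "inj_on (\<lambda>w. {v, w}) (nbrs E v)"
    by (rule inj_onI) (auto simp: doubleton_eq_iff)
  ultimately show ?thesis by (simp add: degree_def card_image)
qed

text \<open>The handshake identity: incident pairs of a vertex and an edge are counted from either
  side.\<close>

lemma sum_degree_eq:
  assumes "simple_graph V E"
  shows "(\<Sum>v\<in>V. degree E v) = 2 * card E"
proof -
  have "card {v \<in> V. v \<in> e} = 2" if "e \<in> E" for e
  proof -
    have "{v \<in> V. v \<in> e} = e" using assms that by (auto simp: simple_graph_def)
    then show ?thesis using assms that by (simp add: simple_graph_def)
  qed
  then have "(\<Sum>v\<in>V. card {e \<in> E. v \<in> e}) = 2 * card E"
    using assms simple_graph_finite[OF assms] by (intro sum_multicount) (auto simp: simple_graph_def)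
  then show ?thesis by (simp add: degree_def)
qed

section \<open>Distances and balance in diameter at most two\<close>

lemma gdist_nonadjacent:
  assumes "u \<noteq> v" "{u, v} \<notin> E"
  shows "gdist V E u v \<ge> 2"
  unfolding gdist_def
proof (rule INF_greatest)
  fix p assume "p \<in> {p. is_path V E u p v}"
  then have p: "is_path V E u p v" by simp
  have "length p \<noteq> 0" "length p \<noteq> 1" "length p \<noteq> 2"
    using p assms by (auto simp: is_path_def length_Suc_conv numeral_2_eq_2)
  then have "2 \<le> length p - 1" by linarith
  then show "2 \<le> enat (length p - 1)" by (simp add: numeral_eq_enat)
qed

lemma gdist_common_nbr:
  assumes sg: "simple_graph V E" and "u \<noteq> v" "{u, w} \<in> E" "{w, v} \<in> E"
  shows "gdist V E u v \<le> 2"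
proof -
  have "is_path V E u [u, w, v] v"
    using assms simple_graph_edgeD[OF sg] by (intro is_path_two) auto
  then have "gdist V E u v \<le> enat (length [u, w, v] - 1)"
    unfolding gdist_def by (intro INF_lower) simp
  then show ?thesis by (simp add: numeral_eq_enat numeral_2_eq_2)
qed

text \<open>Phrased with common neighbours instead of \<open>gdist\<close>, so that it can be
  checked from adjacency alone.\<close>

definition diam_le_2 :: "'a set \<Rightarrow> 'a set set \<Rightarrow> bool" where
  "diam_le_2 V E \<longleftrightarrow> (\<forall>u\<in>V. \<forall>v\<in>V. u \<noteq> v \<longrightarrow> {u, v} \<notin> E \<longrightarrow> (\<exists>w. {u, w} \<in> E \<and> {w, v} \<in> E))"

lemma gdist_diam_le_2:
  assumes "simple_graph V E" "diam_le_2 V E" "u \<in> V" "v \<in> V"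
  shows "gdist V E u v = (if u = v then 0 else if {u, v} \<in> E then 1 else 2)"
proof (cases "u \<noteq> v \<and> {u, v} \<notin> E")
  case True
  then obtain w where "{u, w} \<in> E" "{w, v} \<in> E" using assms by (auto simp: diam_le_2_def)
  then have "gdist V E u v \<le> 2" using gdist_common_nbr assms True by metis
  moreover have "gdist V E u v \<ge> 2" using gdist_nonadjacent True by metis
  ultimately have "gdist V E u v = 2" by (rule order.antisym)
  then show ?thesis using True by simp
qed (use assms in \<open>auto simp: gdist_self gdist_edge\<close>)

text \<open>With all distances at most two, a vertex other than \<open>x\<close> and
  \<open>y\<close> is closer to \<open>x\<close> exactly when it is adjacent to \<open>x\<close> but
  not to \<open>y\<close>. The remaining neighbours of \<open>x\<close>, apart from
  \<open>y\<close>, are the common ones.\<close>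

lemma degree_diam_le_2:
  assumes sg: "simple_graph V E" and d: "diam_le_2 V E" and e: "{x, y} \<in> E"
  shows "degree E x = card (W V E x y) + card (nbrs E x \<inter> nbrs E y)"
proof -
  let ?D = "nbrs E x - nbrs E y - {y}"
  have xy: "x \<in> V" "y \<in> V" "x \<noteq> y" using simple_graph_edgeD[OF sg e] by auto
  have "W V E x y = insert x ?D"
  proof (rule set_eqI)
    fix u
    show "u \<in> W V E x y \<longleftrightarrow> u \<in> insert x ?D"
    proof (cases "u \<in> V")
      case True
      then show ?thesis using xy e
        by (auto simp: W_def gdist_diam_le_2[OF sg d] mem_nbrs insert_commute split: if_splits)
    next
      case False
      then show ?thesis using nbrs_subset[OF sg, of x] xy by (auto simp: W_def)
    qed
  qed
  moreover have "x \<notin> nbrs E x" using nbrs_subset[OF sg] by blast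
  moreover have "y \<notin> nbrs E y" using nbrs_subset[OF sg] by blast
  with e have "y \<in> nbrs E x - nbrs E y" by (simp add: mem_nbrs)
  \<comment> \<open>Leaving \<open>y\<close> out of \<open>?D\<close> makes up for the element
    \<open>x\<close> that \<open>W V E x y\<close> has in addition to \<open>?D\<close>.\<close>
  then have "Suc (card ?D) = card (nbrs E x - nbrs E y)"
    using finite_nbrs[OF sg] by (intro card_Suc_Diff1) auto
  moreover have "card (nbrs E x) = card (nbrs E x \<inter> nbrs E y) + card (nbrs E x - nbrs E y)"
    using finite_nbrs[OF sg] by (rule card_Int_Diff)
  ultimately show ?thesis
    using finite_nbrs[OF sg] by (simp add: degree_eq_card_nbrs[OF sg])
qed

text \<open>The common-neighbour term of \<open>degree_diam_le_2\<close> is symmetric in the two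
  ends of an edge, so it cancels in the comparison.\<close>

lemma distance_balanced_diam_le_2_iff:
  assumes "simple_graph V E" "diam_le_2 V E"
  shows "distance_balanced V E \<longleftrightarrow> (\<forall>x y. {x, y} \<in> E \<longrightarrow> degree E x = degree E y)"
proof -
  have "card (W V E x y) = card (W V E y x) \<longleftrightarrow> degree E x = degree E y" if "{x, y} \<in> E" for x y
    using degree_diam_le_2[OF assms, of x y] degree_diam_le_2[OF assms, of y x] that
    by (simp add: insert_commute Int_commute)
  then show ?thesis by (auto simp: distance_balanced_def)
qed

section \<open>The shape of the starlike tree\<close>

lemma path_leaves_set:
  assumes "is_path V E u p v" "u \<in> U" "v \<notin> U"
  obtains s t where "s \<in> U" "t \<notin> U" "{s, t} \<in> E"
proof -
  have "p \<noteq> []" "p ! 0 = u" "p ! (length p - 1) = v"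
    using assms(1) by (auto simp: is_path_def hd_conv_nth last_conv_nth)
  moreover have "\<exists>i. Suc i < length p \<and> p ! i \<in> U \<and> p ! Suc i \<notin> U"
  proof (rule ccontr)
    assume neg: "\<not> ?thesis"
    \<comment> \<open>If no step left \<open>U\<close>, membership in \<open>U\<close> would
      propagate along the path to its end \<open>v\<close>.\<close>
    have "i < length p \<longrightarrow> p ! i \<in> U" for i
      by (induction i) (use neg calculation assms in auto)
    then show False using calculation assms(3) by (metis diff_less length_greater_0_conv zero_less_one)
  qed
  ultimately show ?thesis using assms(1) that by (auto simp: is_path_def)
qed

text \<open>The component sizes leave one pair \<open>{a, b}\<close> and otherwise singletons once
  the centre is deleted. Connectedness joins the centre to every component, and acyclicity allows
  only one edge from it to the pair.\<close>

lemma starlike_tree_2_1E: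
  assumes m: "m \<ge> 1" and star: "starlike_tree V E (add_mset 2 (replicate_mset (m - 1) 1))"
  obtains c y x1 X where "V = {c, y} \<union> X" "finite X" "card X = m" "c \<notin> X" "y \<notin> X" "c \<noteq> y"
    "x1 \<in> X" "E = (\<lambda>x. {c, x}) ` X \<union> {{x1, y}}"
proof -
  define comp where "comp c u = {v \<in> V - {c}. \<exists>p. is_path (V - {c}) {e \<in> E. c \<notin> e} u p v}" for c u
  obtain c where c: "c \<in> V"
    and L: "let K = components (V - {c}) {e \<in> E. c \<notin> e} in
        (\<forall>C\<in>K. path_graph C {e \<in> E. e \<subseteq> C}) \<and>
        image_mset card (mset_set K) = add_mset 2 (replicate_mset (m - 1) 1)"
    using star unfolding starlike_tree_def by (elim conjE bexE)
  define K where "K = components (V - {c}) {e \<in> E. c \<notin> e}"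
  have Kc: "K = comp c ` (V - {c})" by (simp add: K_def components_def comp_def[abs_def])
  have pg: "\<And>C. C \<in> K \<Longrightarrow> path_graph C {e \<in> E. e \<subseteq> C}"
    and K: "image_mset card (mset_set K) = add_mset 2 (replicate_mset (m - 1) 1)"
    using L by (simp_all only: Let_def K_def)
  have sg: "simple_graph V E" and conn: "connected_graph V E" and acyc: "\<And>q. \<not> is_cycle V E q"
    using star by (auto simp: starlike_tree_def is_tree_def)
  have fV: "finite V" using sg by (simp add: simple_graph_def)
  then have fK: "finite K" by (simp add: Kc)
  \<comment> \<open>Inverting the mapped multiset at its element 2 singles out a component
    \<open>C0\<close> with two vertices; those in \<open>M\<close> all have size 1.\<close>
  obtain M C0 where M: "mset_set K = add_mset C0 M" "card C0 = 2"
      "image_mset card M = replicate_mset (m - 1) 1"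
    using msed_map_invR[OF K] by blast
  have C0: "C0 \<in> K" using M(1) fK by (metis elem_mset_set union_single_eq_member)
  have M': "M = mset_set (K - {C0})"
    using M(1) mset_set.remove[OF fK C0] by simp
  have card1: "card C = 1" if "C \<in> K - {C0}" for C
  proof -
    have "card C \<in># image_mset card M" using that fK by (simp add: M')
    then show ?thesis unfolding M(3) by (simp split: if_splits)
  qed
  have cardK: "card (K - {C0}) = m - 1"
    using arg_cong[OF M(3), of size] by (simp add: M')
  obtain p where p: "distinct p" "set p = C0"
      "{e \<in> E. e \<subseteq> C0} = {{p ! i, p ! Suc i} | i. Suc i < length p}"
    using pg[OF C0] unfolding path_graph_def by blast
  have "length p = 2" using p M(2) distinct_card by metis
  then obtain a b where ab: "p = [a, b]" by (auto simp: length_Suc_conv numeral_2_eq_2)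
  have C0ab: "C0 = {a, b}" "a \<noteq> b" using p ab by auto
  have E0: "{e \<in> E. e \<subseteq> {a, b}} = {{a, b}}" using p(3) ab C0ab by auto
  have KV: "C \<subseteq> V - {c}" if "C \<in> K" for C using that by (auto simp: Kc comp_def)
  have abV: "a \<in> V" "b \<in> V" "a \<noteq> c" "b \<noteq> c" using KV[OF C0] C0ab by auto
  have self: "u \<in> comp c u" if "u \<in> V - {c}" for u
    using is_path_Nil[OF that] that by (auto simp: comp_def)
  have adj: "v \<in> comp c u" if "{u, v} \<in> E" "u \<noteq> c" "v \<noteq> c" for u v
    using simple_graph_edgeD[OF sg that(1)] that
    by (auto simp: comp_def intro!: exI[of _ "[u, v]"] is_path_edge)
  have comp: "comp c u = C0 \<or> comp c u = {u}" if u: "u \<in> V - {c}" for u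
  proof (cases "comp c u = C0")
    case False
    then have "card (comp c u) = 1" using card1 u by (simp add: Kc)
    then obtain w where "comp c u = {w}" by (rule card_1_singletonE)
    then show ?thesis using self[OF u] by simp
  qed simp
  define S where "S = V - {c} - {a, b}"
  have abE: "{a, b} \<in> E" using E0 by blast
  then have baE: "{b, a} \<in> E" by (simp only: insert_commute)
  have compa: "comp c a \<noteq> {a}" "comp c b \<noteq> {b}"
    using adj[OF abE] adj[OF baE] abV C0ab(2) by auto
  \<comment> \<open>Matching the singleton components with the vertices of \<open>S\<close> turns
    the multiplicity \<open>m - 1\<close> into the cardinality of \<open>S\<close>.\<close>
  have "K - {C0} = (\<lambda>u. {u}) ` S"
  proof (intro equalityI subsetI)
    fix C assume C: "C \<in> K - {C0}"
    then obtain u where u: "u \<in> V - {c}" "C = comp c u" by (auto simp: Kc)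
    with comp C have "C = {u}" by blast
    moreover have "u \<noteq> a" "u \<noteq> b" using compa calculation u by auto
    ultimately show "C \<in> (\<lambda>u. {u}) ` S" using u by (auto simp: S_def)
  next
    fix C assume "C \<in> (\<lambda>u. {u}) ` S"
    then obtain u where u: "u \<in> S" "C = {u}" by blast
    then have "comp c u = {u}" using comp[of u] self[of u] C0ab by (auto simp: S_def)
    moreover have "comp c u \<in> K" using u by (auto simp: Kc S_def)
    ultimately show "C \<in> K - {C0}" using u C0ab by auto
  qed
  then have cardS: "card S = m - 1" using cardK by (simp add: card_image)
  \<comment> \<open>An edge avoiding \<open>c\<close> puts two vertices into one component, which
    must then be \<open>C0\<close>.\<close>
  have noc: "e = {a, b}" if e: "e \<in> E" "c \<notin> e" for e
  proof -
    obtain u v where uv: "e = {u, v}" "u \<noteq> v" "u \<in> V" "v \<in> V"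
      using simple_graph_edgeE[OF sg e(1)] by blast
    then have v: "v \<in> comp c u" using adj e by auto
    have u: "u \<in> V - {c}" using uv e by auto
    have "comp c u \<noteq> {u}" using v uv(2) by (metis singletonD)
    with comp[OF u] have "comp c u = C0" by blast
    then have "e \<subseteq> {a, b}" using v self[OF u] uv(1) C0ab(1) by simp
    then show ?thesis using E0 e(1) by blast
  qed
  \<comment> \<open>A path from \<open>u\<close> to \<open>c\<close> has to leave \<open>U\<close>.
    The leaving edge cannot be \<open>{a, b}\<close>, since \<open>U\<close> does not separate
    \<open>a\<close> from \<open>b\<close>, so by \<open>noc\<close> it ends in
    \<open>c\<close>.\<close>
  have cut: "\<exists>s\<in>U. {c, s} \<in> E" if U: "u \<in> U" "U \<subseteq> V - {c}" "U \<inter> {a, b} = {} \<or> {a, b} \<subseteq> U" for u U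
  proof -
    have "u \<in> V" using U by blast
    then obtain p where "is_path V E u p c" using conn c unfolding connected_graph_def by blast
    then obtain s t where st: "s \<in> U" "t \<notin> U" "{s, t} \<in> E"
      using path_leaves_set[of V E u p c U] U by blast
    have "t = c"
    proof (rule ccontr)
      assume "t \<noteq> c"
      then have "{s, t} = {a, b}" using noc[OF st(3)] st U by auto
      then have "a \<in> U \<longleftrightarrow> b \<notin> U" using st(1,2) unfolding doubleton_eq_iff by blast
      then show False using U(3) by blast
    qed
    then have "{c, s} \<in> E" using st(3) by (simp add: insert_commute)
    then show ?thesis using st(1) by blast
  qed
  have Sc: "{c, s} \<in> E" if "s \<in> S" for s
    using cut[of s "{s}"] that by (auto simp: S_def)
  \<comment> \<open>Both edges together with \<open>{a, b}\<close> would form a triangle.\<close>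
  have "\<not> ({c, a} \<in> E \<and> {c, b} \<in> E)"
  proof
    assume "{c, a} \<in> E \<and> {c, b} \<in> E"
    then have cab: "{c, a} \<in> E" "{b, c} \<in> E" by (simp_all add: insert_commute)
    have len: "length [c, a, b] = 3" by simp
    have nth: "[c, a, b] ! 0 = c" "[c, a, b] ! 1 = a" "[c, a, b] ! 2 = b" by simp_all
    have suc: "Suc 0 mod 3 = 1" "Suc 1 mod 3 = 2" "Suc 2 mod 3 = 0" by simp_all
    have "{[c, a, b] ! i, [c, a, b] ! (Suc i mod 3)} \<in> E" if "i < 3" for i
    proof -
      consider "i = 0" | "i = 1" | "i = 2" using \<open>i < 3\<close> by linarith
      then show ?thesis by cases (simp_all only: suc nth cab abE)
    qed
    then have "is_cycle V E [c, a, b]"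
      unfolding is_cycle_def len using abV c C0ab(2) by simp
    with acyc show False by blast
  qed
  moreover have "{c, a} \<in> E \<or> {c, b} \<in> E" using cut[of a "{a, b}"] abV by auto
  \<comment> \<open>The end of the pair that is joined to the centre becomes \<open>x1\<close>, the
    other end becomes the leaf \<open>y\<close>.\<close>
  ultimately obtain x1 y where xy: "x1 = a \<and> y = b \<or> x1 = b \<and> y = a" "{c, x1} \<in> E" "{c, y} \<notin> E"
    by blast
  have xyE: "{x1, y} = {a, b}" using xy(1) by blast
  have xy': "x1 \<noteq> y" "x1 \<in> {a, b}" "y \<in> {a, b}" using xy(1) C0ab by auto
  show ?thesis
  proof (rule that[of c y "insert x1 S" x1])
    show "V = {c, y} \<union> insert x1 S" using c abV xy(1) unfolding S_def by blast
    show "finite (insert x1 S)" using fV by (simp add: S_def)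
    have "x1 \<notin> S" using xy' by (auto simp: S_def)
    then show "card (insert x1 S) = m" using cardS m fV by (simp add: S_def)
    show "c \<notin> insert x1 S" "y \<notin> insert x1 S" "c \<noteq> y" "x1 \<in> insert x1 S"
      using abV xy' by (auto simp: S_def)
    show "E = (\<lambda>x. {c, x}) ` insert x1 S \<union> {{x1, y}}"
    proof (intro equalityI subsetI)
      fix e assume e: "e \<in> E"
      show "e \<in> (\<lambda>x. {c, x}) ` insert x1 S \<union> {{x1, y}}"
      proof (cases "c \<in> e")
        case True
        obtain u v where "e = {u, v}" "u \<noteq> v" "u \<in> V" "v \<in> V"
          using simple_graph_edgeE[OF sg e] by blast
        with True obtain w where w: "e = {c, w}" "w \<in> V - {c}"
          by (metis Diff_iff insertE insert_commute singletonD)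
        then have "w \<noteq> y" using e xy by auto
        then have "w \<in> insert x1 S" using w xy(1) unfolding S_def by blast
        then show ?thesis using w by auto
      next
        case False
        then show ?thesis using noc[OF e] xyE by simp
      qed
    next
      fix e assume "e \<in> (\<lambda>x. {c, x}) ` insert x1 S \<union> {{x1, y}}"
      then consider s where "e = {c, s}" "s \<in> insert x1 S" | "e = {a, b}" unfolding xyE by blast
      then show "e \<in> E" using Sc xy(2) abE by cases auto
    qed
  qed
qed

lemma card_star_plus_edge:
  assumes "finite X" "c \<notin> X" "c \<noteq> y" "x1 \<in> X"
  shows "card ((\<lambda>x. {c, x}) ` X \<union> {{x1, y}}) = card X + 1"
proof -
  have "inj_on (\<lambda>x. {c, x}) X" by (rule inj_onI) (auto simp: doubleton_eq_iff)
  moreover have "{x1, y} \<notin> (\<lambda>x. {c, x}) ` X" using assms by (auto simp: doubleton_eq_iff)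
  ultimately show ?thesis using assms by (simp add: card_image)
qed

section \<open>Regularity of distance-balanced supergraphs\<close>

lemma distance_balanced_supergraph_regular:
  assumes sg: "simple_graph V E" and db: "distance_balanced V E"
    and V: "V = {c, y} \<union> X" "finite X" "c \<notin> X" "y \<notin> X" "c \<noteq> y"
    and x1: "x1 \<in> X" "{x1, y} \<in> E" and cX: "\<And>x. x \<in> X \<Longrightarrow> {c, x} \<in> E"
  obtains k where "k = card X \<or> k = card X + 1" "\<And>v. v \<in> V \<Longrightarrow> degree E v = k"
proof -
  have Xc: "{x, c} \<in> E" if "x \<in> X" for x using cX[OF that] by (simp add: insert_commute)
  have yx1: "{y, x1} \<in> E" using x1 by (simp add: insert_commute)
  have cV: "c \<in> V" using V by simp
  have yx: "\<exists>w. {y, w} \<in> E \<and> {w, x} \<in> E" if x: "x \<in> X" "{y, x} \<notin> E" for x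
  proof (cases "{c, y} \<in> E")
    case True
    then have "{y, c} \<in> E" by (simp add: insert_commute)
    then show ?thesis using cX[OF x(1)] by blast
  next
    case False
    have xV: "x \<in> V" "x \<noteq> c" "x \<noteq> y" "x \<noteq> x1" using x V x1 yx1 by auto
    \<comment> \<open>The other vertices of \<open>X\<close> are at distance 1 from \<open>c\<close>
      and at least 1 from \<open>x\<close>; the vertex \<open>y\<close> is within 2 of
      \<open>c\<close> through \<open>x1\<close> and at least 2 away from \<open>x\<close>.\<close>
    have "W V E x c \<subseteq> {x}"
    proof
      fix u assume "u \<in> W V E x c"
      then have u: "u \<in> V" "gdist V E u x < gdist V E u c" by (auto simp: W_def)
      show "u \<in> {x}"
      proof (rule ccontr)
        assume "u \<notin> {x}"
        then have ux: "u \<noteq> x" by simp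
        have "u \<noteq> c" using u gdist_self[OF cV] by auto
        then consider "u = y" | "u \<in> X" using u V by auto
        then show False
        proof cases
          case 1
          have "gdist V E y c \<le> 2" using gdist_common_nbr[OF sg _ yx1 Xc[OF x1(1)]] V by auto
          moreover have "gdist V E y x \<ge> 2" using xV x by (intro gdist_nonadjacent) auto
          ultimately show False using u 1 by simp
        next
          case 2
          have "gdist V E u c = 1" using 2 Xc u cV V by (intro gdist_edge) auto
          then show False using u gdist_pos[OF ux, of V E] by (simp add: not_less[symmetric])
        qed
      qed
    qed
    \<comment> \<open>Balance leaves room for one vertex in \<open>W V E c x\<close>, and
      \<open>c\<close> takes it. So \<open>x1\<close>, at distance 1 from \<open>c\<close>, is no
      farther from \<open>x\<close>, which makes \<open>x1\<close> a common neighbour of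
      \<open>x\<close> and \<open>y\<close>.\<close>
    then have "card (W V E x c) \<le> 1" using card_mono[of "{x}"] by simp
    then have "card (W V E c x) \<le> 1"
      using db Xc[OF x(1)] unfolding distance_balanced_def by metis
    moreover have "finite (W V E c x)" using V by (simp add: W_def)
    moreover have "c \<in> W V E c x"
      using cV gdist_self[OF cV, of E] gdist_pos[of c x V E] xV
      by (auto simp: W_def intro: less_le_trans[of 0 1])
    ultimately have "x1 \<notin> W V E c x" using x1 V
      by (metis One_nat_def card_le_Suc0_iff_eq)
    moreover have "gdist V E x1 c = 1" using x1 Xc cV V by (intro gdist_edge) auto
    ultimately have "gdist V E x1 x \<le> 1" using x1 V by (auto simp: W_def not_less)
    moreover have "\<not> (2::enat) \<le> 1" by (simp add: one_enat_def numeral_eq_enat)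
    ultimately have "{x1, x} \<in> E" using gdist_nonadjacent[of x1 x E V] xV by (metis order_trans)
    then show ?thesis using yx1 by blast
  qed
  have diam: "diam_le_2 V E"
    unfolding diam_le_2_def
  proof (intro ballI impI)
    fix u v assume uv: "u \<in> V" "v \<in> V" "u \<noteq> v" "{u, v} \<notin> E"
    \<comment> \<open>Two vertices of \<open>X\<close> share the neighbour \<open>c\<close>, and
      \<open>c\<close> and \<open>y\<close> share \<open>x1\<close>; pairs of \<open>y\<close> and a
      vertex of \<open>X\<close> are covered by \<open>yx\<close>.\<close>
    consider "u \<in> X" "v \<in> X" | "u = c" "v = y" | "u = y" "v = c" | "u = y" "v \<in> X" | "v = y" "u \<in> X"
      using uv V cX Xc by auto
    then show "\<exists>w. {u, w} \<in> E \<and> {w, v} \<in> E"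
    proof cases
      case 1 then show ?thesis using Xc cX by blast
    next
      case 2 then show ?thesis using cX x1 by blast
    next
      case 3 then show ?thesis using Xc x1 yx1 by blast
    next
      case 4 then show ?thesis using yx uv by blast
    next
      case 5 then show ?thesis using yx[of u] uv by (auto simp: insert_commute)
    qed
  qed
  have eq: "degree E u = degree E v" if "{u, v} \<in> E" for u v
    using db that distance_balanced_diam_le_2_iff[OF sg diam] by blast
  have "X \<subseteq> nbrs E c" using cX by (auto simp: mem_nbrs)
  moreover have "nbrs E c \<subseteq> insert y X" using nbrs_subset[OF sg, of c] V by auto
  ultimately have "nbrs E c = X \<or> nbrs E c = insert y X" by auto
  then have "degree E c = card X \<or> degree E c = card X + 1"
    using V(2,4) degree_eq_card_nbrs[OF sg, of c] by auto
  \<comment> \<open>Equality of degrees passes along the edges from \<open>c\<close> to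
    \<open>X\<close> and from \<open>x1\<close> to \<open>y\<close>.\<close>
  moreover have "degree E v = degree E c" if "v \<in> V" for v
    using that V eq[OF Xc] eq[OF yx1] x1 by auto
  ultimately show ?thesis using that by blast
qed

section \<open>Perfect matchings and their complements\<close>

lemma even_card_involution:
  assumes "finite X" "even (card X)"
  shows "\<exists>f. \<forall>x\<in>X. f x \<in> X \<and> f x \<noteq> x \<and> f (f x) = x"
proof -
  let ?n = "card X"
  obtain h where h: "bij_betw h {0..<?n} X" using ex_bij_betw_nat_finite[OF assms(1)] ..
  \<comment> \<open>Swaps the indices \<open>2 * j\<close> and \<open>2 * j + 1\<close>. Evenness of
    \<open>?n\<close> keeps the partner of the last index in range, and an odd index is positive, so
    \<open>i - 1\<close> is not truncated.\<close>
  define s where "s i = (if even i then i + 1 else i - 1)" for i :: nat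
  have s: "s i < ?n" "s i \<noteq> i" "s (s i) = i" if "i < ?n" for i
  proof -
    have "even i \<Longrightarrow> Suc i \<noteq> ?n" using assms(2) by (metis even_Suc)
    then show "s i < ?n" using that unfolding s_def by auto
    have "odd i \<Longrightarrow> i > 0" by (rule odd_pos)
    then show "s i \<noteq> i" "s (s i) = i" by (auto simp: s_def)
  qed
  let ?g = "inv_into {0..<?n} h"
  have g: "?g x < ?n" "h (?g x) = x" if "x \<in> X" for x
    using bij_betw_inv_into_right[OF h that] bij_betw_apply[OF bij_betw_inv_into[OF h] that] by simp_all
  have gh: "?g (h i) = i" if "i < ?n" for i
    using bij_betw_inv_into_left[OF h] that by simp
  have hX: "h i \<in> X" if "i < ?n" for i using bij_betw_apply[OF h] that by simp
  show ?thesis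
  proof (intro exI[of _ "\<lambda>x. h (s (?g x))"] ballI conjI)
    fix x assume x: "x \<in> X"
    note i = g(1)[OF x]
    show "h (s (?g x)) \<in> X" using hX s(1) i by simp
    show "h (s (?g x)) \<noteq> x" using gh[OF s(1)[OF i]] s(2)[OF i] by metis
    show "h (s (?g (h (s (?g x))))) = x" using gh[OF s(1)[OF i]] s(3)[OF i] g(2)[OF x] by simp
  qed
qed

text \<open>A fixed-point-free involution encodes a perfect matching. In its complement the only
  nonadjacent pairs are the matched ones, and any third vertex is adjacent to both ends of such a
  pair.\<close>

lemma matching_complement_distance_balanced:
  fixes V :: "'a set"
  assumes V: "finite V" "card V \<ge> 3"
    and f: "\<And>v. v \<in> V \<Longrightarrow> f v \<in> V \<and> f v \<noteq> v \<and> f (f v) = v"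
  defines "E \<equiv> {e. e \<subseteq> V \<and> card e = 2} - (\<lambda>v. {v, f v}) ` V"
  shows "simple_graph V E" "distance_balanced V E" "\<And>v. v \<in> V \<Longrightarrow> degree E v = card V - 2"
proof -
  show sg: "simple_graph V E" using V by (auto simp: simple_graph_def E_def)
  have adj: "{u, v} \<in> E \<longleftrightarrow> u \<in> V \<and> v \<in> V \<and> v \<noteq> u \<and> v \<noteq> f u" for u v
  proof -
    \<comment> \<open>As \<open>f\<close> is an involution, a matched pair is indexed by each of its
      ends.\<close>
    have "{u, v} \<in> (\<lambda>v. {v, f v}) ` V \<longleftrightarrow> u \<in> V \<and> v = f u"
      using f by (auto simp: doubleton_eq_iff)
    then show ?thesis by (auto simp: E_def card_2_iff doubleton_eq_iff)
  qed
  show deg: "degree E v = card V - 2" if "v \<in> V" for v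
  proof -
    have "nbrs E v = V - {v, f v}" unfolding nbrs_def adj using that by blast
    moreover have "card {v, f v} = 2" using f[OF that] by (simp add: eq_commute)
    ultimately show ?thesis using that f[OF that] V
      by (simp add: degree_eq_card_nbrs[OF sg] card_Diff_subset)
  qed
  have "diam_le_2 V E"
    unfolding diam_le_2_def
  proof (intro ballI impI)
    fix u v assume uv: "u \<in> V" "v \<in> V" "u \<noteq> v" "{u, v} \<notin> E"
    then have v: "v = f u" by (auto simp: adj)
    have "card {u, v} < card V" using V uv by simp
    then obtain w where w: "w \<in> V" "w \<notin> {u, v}"
      using card_mono[of "{u, v}" V] by (metis finite.emptyI finite_insert not_less subsetI)
    \<comment> \<open>Otherwise \<open>w = f v = u\<close>.\<close>
    have "v \<noteq> f w" using w v f uv by (metis insertI1)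
    then show "\<exists>w. {u, w} \<in> E \<and> {w, v} \<in> E" using uv v w by (auto simp: adj)
  qed
  then show "distance_balanced V E"
    using deg simple_graph_edgeD[OF sg] by (simp add: distance_balanced_diam_le_2_iff[OF sg])
qed

section \<open>Counting the added edges\<close>

theorem theorem3p3:
  fixes V :: "'a set" and E :: "'a set set" and m :: nat
  assumes "m \<ge> 3"
    and "starlike_tree V E (add_mset 2 (replicate_mset (m - 1) 1))"
  shows "real (b V E) = (if even m then (real m)\<^sup>2 / 2 - 1 else real ((m + 1) choose 2))"
proof -
  obtain c y x1 X where V: "V = {c, y} \<union> X" "finite X" "card X = m" "c \<notin> X" "y \<notin> X" "c \<noteq> y"
    and x1: "x1 \<in> X" and E: "E = (\<lambda>x. {c, x}) ` X \<union> {{x1, y}}"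
    by (rule starlike_tree_2_1E[OF _ assms(2)]) (use assms(1) in linarith)
  have sg: "simple_graph V E" using assms(2) by (simp add: starlike_tree_def is_tree_def)
  have cardV: "card V = m + 2" using V by simp
  have cardE: "card E = m + 1" using card_star_plus_edge[of X c y x1] V x1 E by simp
  have edges: "2 * card E' = (m + 2) * k"
    if "simple_graph V E'" "\<And>v. v \<in> V \<Longrightarrow> degree E' v = k" for E' k
    using sum_degree_eq[OF that(1)] that(2) cardV by simp
  obtain F where F: "F \<inter> E = {}" "card F = b V E" "simple_graph V (E \<union> F)"
      "distance_balanced V (E \<union> F)"
    using b_attained[OF sg] by blast
  obtain k where k: "k = m \<or> k = m + 1" "\<And>v. v \<in> V \<Longrightarrow> degree (E \<union> F) v = k"
    using distance_balanced_supergraph_regular[OF F(3,4), of c y X x1] V x1 E by auto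
  have "card (E \<union> F) = m + 1 + b V E"
    using F cardE simple_graph_finite[OF F(3)] by (subst card_Un_disjoint) auto
  \<comment> \<open>The handshake identity for an optimal supergraph: only the choice between the
    two values of \<open>k\<close> remains.\<close>
  with edges[OF F(3) k(2)] have bk: "2 * (m + 1 + b V E) = (m + 2) * k" by simp
  show ?thesis
  proof (cases "even m")
    case True
    \<comment> \<open>As \<open>c\<close> is already joined to all of \<open>X\<close>, its partner
      in a matching that avoids \<open>E\<close> can only be \<open>y\<close>; the even set
      \<open>X\<close> is paired within itself.\<close>
    obtain g where g: "\<forall>x\<in>X. g x \<in> X \<and> g x \<noteq> x \<and> g (g x) = x"
      using even_card_involution V True by blast
    define f where "f v = (if v = c then y else if v = y then c else g v)" for v
    have f: "f v \<in> V \<and> f v \<noteq> v \<and> f (f v) = v" if "v \<in> V" for v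
    proof -
      have "g v \<noteq> c" "g v \<noteq> y" if "v \<in> X" for v using g that V by metis+
      then show ?thesis using that V g by (auto simp: f_def)
    qed
    define E' where "E' = {e. e \<subseteq> V \<and> card e = 2} - (\<lambda>v. {v, f v}) ` V"
    have E': "simple_graph V E'" "distance_balanced V E'" "\<And>v. v \<in> V \<Longrightarrow> degree E' v = m"
      using matching_complement_distance_balanced[of V f] V cardV assms(1) f
      by (auto simp: E'_def)
    \<comment> \<open>Every edge of the tree contains exactly one of \<open>c\<close> and
      \<open>y\<close>, while the only matched pair meeting \<open>{c, y}\<close> is
      \<open>{c, y}\<close> itself.\<close>
    have "E \<inter> (\<lambda>v. {v, f v}) ` V = {}"
    proof -
      have fcy: "f c = y" "f y = c" using V(6) by (simp_all add: f_def)
      have pair: "{v, f v} = {c, y}" if "v \<in> V" "c \<in> {v, f v} \<or> y \<in> {v, f v}" for v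
      proof -
        have "v = c \<or> v = y" using that f[OF that(1)] fcy by (metis insertE singletonD)
        then show ?thesis using fcy by (auto simp only: insert_commute)
      qed
      have "{c, x} \<noteq> {v, f v}" if "x \<in> X" "v \<in> V" for x v
      proof
        assume "{c, x} = {v, f v}"
        with pair[OF that(2)] have "{c, x} = {c, y}" by blast
        then show False using that V by (metis doubleton_eq_iff)
      qed
      moreover have "{x1, y} \<noteq> {v, f v}" if "v \<in> V" for v
      proof
        assume "{x1, y} = {v, f v}"
        with pair[OF that] have "{x1, y} = {c, y}" by blast
        then show False using x1 V by (metis doubleton_eq_iff)
      qed
      ultimately show ?thesis unfolding E by blast
    qed
    then have sub: "E \<subseteq> E'" using sg by (auto simp: E'_def simple_graph_def)
    then have un: "E \<union> (E' - E) = E'" by auto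
    \<comment> \<open>\<open>E' - E\<close> is an admissible set of added edges, so the optimal
      supergraph has at most as many edges as the \<open>m\<close>-regular \<open>E'\<close>. This
      excludes \<open>k = m + 1\<close>.\<close>
    have "b V E \<le> card (E' - E)"
      unfolding b_def by (rule Least_le, rule exI[of _ "E' - E"]) (use E' un in auto)
    moreover have "card (E' - E) = card E' - (m + 1)"
      using sub cardE simple_graph_finite[OF sg] by (simp add: card_Diff_subset)
    \<comment> \<open>Ensures that the subtraction in \<open>card E' - (m + 1)\<close> is not
      truncated.\<close>
    moreover have "card E' \<ge> m + 1"
      using sub cardE simple_graph_finite[OF E'(1)] card_mono by metis
    ultimately have "2 * (m + 1 + b V E) \<le> (m + 2) * m" using edges[OF E'(1,3)] by simp
    then have "k = m" using bk k(1) by auto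
    then have "real (2 * (m + 1 + b V E)) = real ((m + 2) * m)" using bk by (simp only:)
    then have "2 + 2 * real (b V E) = (real m)\<^sup>2" by (simp add: power2_eq_square algebra_simps)
    then show ?thesis using True by simp
  next
    case False
    \<comment> \<open>For odd \<open>m\<close> the product \<open>(m + 2) * m\<close> is odd and
      cannot be twice an edge count.\<close>
    have "k \<noteq> m"
    proof
      assume "k = m"
      then have "even ((m + 2) * m)" using bk by (metis dvd_triv_left)
      then show False using False by simp
    qed
    then have "2 * b V E = m * (m + 1)" using bk k(1) by (simp add: algebra_simps)
    \<comment> \<open>The division by 2 in \<open>choose_two\<close> is exact, because
      \<open>m + 1\<close> is even.\<close>
    moreover have "2 * ((m + 1) choose 2) = m * (m + 1)"
      using False by (simp add: choose_two)
    ultimately show ?thesis using False by simp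
  qed
qed

end
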